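(* Let $X$ be a compact Polish space, $c\in\mathcal D_1$, $\varepsilon>0$, $\alpha\in(0,1)$ and $\mu,\nu\in\mathcal P(X)$. The optimal dual potentials, i.e. the maximizers $(\hat f,\hat g)\in C(X)^2$ of $$\sup_{\substack{f,g\in C(X)\\ f\oplus g<c\ \mu\otimes\nu\text{-a.e.}}}\ \langle f\oplus g,\mu\otimes\nu\rangle-\varepsilon\ln\left(\left\langle (c-f\oplus g)^{\frac{\alpha}{\alpha-1}},\mu\otimes\nu\right\rangle\right)+C_{\alpha,\varepsilon},$$ are unique on $\operatorname{supp}(\mu)$ and $\operatorname{supp}(\nu)$, respectively, up to additive constants. That is, for any two optimal pairs $(\hat f,\hat g),(\tilde f,\tilde g)\in C(X)^2$ there exists $\gamma\in\mathbb R$ such that $\hat f-\tilde f\equiv\gamma$ $\mu$-almost everywhere and $\hat g-\tilde g\equiv-\gamma$ $\nu$-almost everywhere.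
   Context: $\mathcal P(X)$ is the set of Borel probability measures; $C(X)$ the continuous real functions on $X$. $\mathcal D_1$ is the set of metrics $c=d:X\times X\to[0,\infty)$ that are weakly lower semicontinuous (read: lower semicontinuous for the topology of $X\times X$). $(f\oplus g)(x,y):=f(x)+g(y)$; $\langle h,\pi\rangle=\int h\,d\pi$. $C_{\alpha,\varepsilon}:=-\varepsilon\frac{\alpha}{1-\alpha}\ln(\varepsilon)-\varepsilon C_\alpha$ with $C_\alpha:=\frac{\alpha}{1-\alpha}\left(\ln\left(\frac{\alpha}{1-\alpha}\right)-1\right)$. The displayed problem is the dual of $\min_{\pi\in\Pi(\mu,\nu)}\langle c,\pi\rangle+\varepsilon R_\alpha(\pi\mid\mu\otimes\nu)$, where $\Pi(\mu,\nu)$ is the set of couplings of $\mu,\nu$ and $R_\alpha$ is the $\alpha$-Rényi divergence. *)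

theory Defs
  imports "HOL-Probability.Probability"
begin

definition lsc :: "('a :: topological_space \<Rightarrow> real) \<Rightarrow> bool" where
  "lsc h \<longleftrightarrow> (\<forall>a. open {z. a < h z})"

definition D1 :: "('a :: topological_space \<times> 'a \<Rightarrow> real) set" where
  "D1 = {c. Metric_space UNIV (\<lambda>x y. c (x, y)) \<and> lsc c}"

text \<open>The topology is the ambient one of the type; the metrics in \<^const>\<open>D1\<close> need not induce it.\<close>

abbreviation Prob :: "('a :: topological_space) measure set" where
  "Prob \<equiv> space (prob_algebra borel)"

definition supp :: "('a :: topological_space) measure \<Rightarrow> 'a set" where
  "supp \<mu> = {x. \<forall>U. open U \<and> x \<in> U \<longrightarrow> emeasure \<mu> U > 0}"

definition osum :: "('a \<Rightarrow> real) \<Rightarrow> ('b \<Rightarrow> real) \<Rightarrow> 'a \<times> 'b \<Rightarrow> real" (infixl \<open>\<oplus>\<^sub>o\<close> 65) where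
  "f \<oplus>\<^sub>o g = (\<lambda>(x, y). f x + g y)"

definition eln :: "ennreal \<Rightarrow> ereal" where
  "eln t = (if t = \<infinity> then \<infinity> else if t = 0 then -\<infinity> else ereal (ln (enn2real t)))"

definition C_alpha :: "real \<Rightarrow> real" where
  "C_alpha \<alpha> = \<alpha> / (1 - \<alpha>) * (ln (\<alpha> / (1 - \<alpha>)) - 1)"

definition C_alpha_eps :: "real \<Rightarrow> real \<Rightarrow> real" where
  "C_alpha_eps \<alpha> \<epsilon> = - \<epsilon> * (\<alpha> / (1 - \<alpha>)) * ln \<epsilon> - \<epsilon> * C_alpha \<alpha>"

definition feasible ::
  "('a :: topological_space \<times> 'a \<Rightarrow> real) \<Rightarrow> 'a measure \<Rightarrow> 'a measure
    \<Rightarrow> (('a \<Rightarrow> real) \<times> ('a \<Rightarrow> real)) set" where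
  "feasible c \<mu> \<nu> = {(f, g). continuous_on UNIV f \<and> continuous_on UNIV g \<and>
     (AE z in \<mu> \<Otimes>\<^sub>M \<nu>. (f \<oplus>\<^sub>o g) z < c z)}"

text \<open>
  For feasible potentials the power below has a base that is positive almost everywhere, but its
  exponent is negative, so that its integral may be infinite; the objective is then \<open>-\<infinity>\<close>.
\<close>

definition dual_objective ::
  "real \<Rightarrow> real \<Rightarrow> ('a :: topological_space \<times> 'a \<Rightarrow> real) \<Rightarrow> 'a measure \<Rightarrow> 'a measure
    \<Rightarrow> ('a \<Rightarrow> real) \<times> ('a \<Rightarrow> real) \<Rightarrow> ereal" where
  "dual_objective \<alpha> \<epsilon> c \<mu> \<nu> = (\<lambda>(f, g).
     ereal (\<integral>z. (f \<oplus>\<^sub>o g) z \<partial>(\<mu> \<Otimes>\<^sub>M \<nu>))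
     - ereal \<epsilon> * eln (\<integral>\<^sup>+z. ennreal ((c z - (f \<oplus>\<^sub>o g) z) powr (\<alpha> / (\<alpha> - 1))) \<partial>(\<mu> \<Otimes>\<^sub>M \<nu>))
     + ereal (C_alpha_eps \<alpha> \<epsilon>))"

definition dual_value ::
  "real \<Rightarrow> real \<Rightarrow> ('a :: topological_space \<times> 'a \<Rightarrow> real) \<Rightarrow> 'a measure \<Rightarrow> 'a measure \<Rightarrow> ereal" where
  "dual_value \<alpha> \<epsilon> c \<mu> \<nu> = (SUP p \<in> feasible c \<mu> \<nu>. dual_objective \<alpha> \<epsilon> c \<mu> \<nu> p)"

definition optimal_potentials ::
  "real \<Rightarrow> real \<Rightarrow> ('a :: topological_space \<times> 'a \<Rightarrow> real) \<Rightarrow> 'a measure \<Rightarrow> 'a measure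
    \<Rightarrow> (('a \<Rightarrow> real) \<times> ('a \<Rightarrow> real)) set" where
  "optimal_potentials \<alpha> \<epsilon> c \<mu> \<nu> =
     {p \<in> feasible c \<mu> \<nu>. dual_objective \<alpha> \<epsilon> c \<mu> \<nu> p = dual_value \<alpha> \<epsilon> c \<mu> \<nu>}"

end

theory Submission
  imports Defs
begin

text \<open>
  With \<open>q = \<alpha> / (\<alpha> - 1) < 0\<close>, the functional \<open>h \<mapsto> ln (\<integral> h powr q)\<close> is strictly convex on positive
  functions: AM-GM gives \<open>((h + k) / 2) powr q \<le> h powr (q/2) * k powr (q/2)\<close>, strictly where
  \<open>h \<noteq> k\<close>, and Cauchy-Schwarz bounds the integral of the right-hand side. The rest of the dual
  objective is affine in the potentials, so the midpoint of two maximizers forces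
  \<open>c - f \<oplus> g = c - f' \<oplus> g'\<close> almost everywhere. Hence \<open>f x - f' x = g' y - g y\<close> for almost every
  \<open>(x, y)\<close>, so by Fubini both sides are constant. Continuity carries this over to the supports.
\<close>

section \<open>Strict midpoint convexity of the logarithm of a negative power integral\<close>

lemma midpoint_powr_le:
  fixes a b q s :: real
  assumes "a > 0" "b > 0" "q < 0" "s > 0"
  shows "((a + b) / 2) powr q \<le> (s * a powr q + b powr q / s) / 2"
    and "a \<noteq> b \<Longrightarrow> ((a + b) / 2) powr q < (s * a powr q + b powr q / s) / 2"
proof -
  define x y where "x = a powr (q / 2)" and "y = b powr (q / 2)"
  have sq: "a powr q = x\<^sup>2" "b powr q = y\<^sup>2"
    using assms by (simp_all add: x_def y_def power2_eq_square flip: powr_add)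
  \<comment> \<open>Weighted AM-GM: dividing the square by \<open>s\<close> leaves a cross term free
    of \<open>s\<close>. The weight stays free so that one choice of it, made after integration,
    yields Cauchy-Schwarz.\<close>
  have "0 \<le> (s * x - y)\<^sup>2 / s" using \<open>s > 0\<close> by simp
  also have "\<dots> = s * x\<^sup>2 + y\<^sup>2 / s - 2 * (x * y)"
    using \<open>s > 0\<close> by (simp add: power2_eq_square field_simps)
  finally have weighted: "x * y \<le> (s * a powr q + b powr q / s) / 2" using sq by simp
  have xy: "x * y = (a * b) powr (q / 2)"
    using assms by (simp add: x_def y_def powr_mult)
  have mid: "((a + b) / 2) powr q = (((a + b) / 2)\<^sup>2) powr (q / 2)"
    using assms by (simp add: powr_powr flip: powr_numeral)
  \<comment> \<open>The gap in the unweighted AM-GM is an explicit square. It is the source of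
    strictness when \<open>a \<noteq> b\<close>, since the weighted bound can be an equality; the
    negative exponent reverses the order.\<close>
  have diff: "((a + b) / 2)\<^sup>2 = a * b + ((a - b) / 2)\<^sup>2"
    by (simp add: power2_eq_square field_simps)
  have "((a + b) / 2) powr q \<le> x * y"
    unfolding mid xy using assms by (intro powr_mono2') (auto simp: diff)
  with weighted show "((a + b) / 2) powr q \<le> (s * a powr q + b powr q / s) / 2" by simp
  assume "a \<noteq> b"
  then have "((a + b) / 2) powr q < x * y"
    unfolding mid xy using assms by (intro powr_less_mono2_neg) (auto simp: diff)
  with weighted show "((a + b) / 2) powr q < (s * a powr q + b powr q / s) / 2" by simp
qed

text \<open>If the integral were zero, the integrand would vanish almost everywhere, although it is
  positive there. This positivity allows logarithms of such integrals to be compared and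
  cancelled.\<close>

lemma (in prob_space) integral_powr_pos:
  fixes h :: "'a \<Rightarrow> real"
  assumes "integrable M (\<lambda>z. h z powr q)" "AE z in M. h z > 0"
  shows "(\<integral>z. h z powr q \<partial>M) > 0"
proof -
  have "(\<integral>z. h z powr q \<partial>M) \<noteq> 0"
  proof
    assume "(\<integral>z. h z powr q \<partial>M) = 0"
    then have "AE z in M. h z powr q = 0"
      using integral_nonneg_eq_0_iff_AE[OF assms(1)] by simp
    with assms(2) have "AE z in M. False" by eventually_elim simp
    then show False by simp
  qed
  moreover have "(\<integral>z. h z powr q \<partial>M) \<ge> 0" by (intro integral_nonneg_AE) simp
  ultimately show ?thesis by linarith
qed

text \<open>The premise of the second claim is midpoint convexity reversed, which is the form that
  optimality delivers. It forces equality in the integrated bound, hence almost everywhere in the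
  pointwise one, whose strict case then excludes \<open>h z \<noteq> k z\<close>.\<close>

lemma (in prob_space) ln_integral_powr_strict_midconvex:
  fixes h k :: "'a \<Rightarrow> real"
  assumes [measurable]: "h \<in> borel_measurable M" "k \<in> borel_measurable M"
    and pos: "AE z in M. h z > 0" "AE z in M. k z > 0"
    and int: "integrable M (\<lambda>z. h z powr q)" "integrable M (\<lambda>z. k z powr q)"
    and "q < 0"
  shows "integrable M (\<lambda>z. ((h z + k z) / 2) powr q)"
    and "(ln (\<integral>z. h z powr q \<partial>M) + ln (\<integral>z. k z powr q \<partial>M)) / 2
           \<le> ln (\<integral>z. ((h z + k z) / 2) powr q \<partial>M) \<Longrightarrow> AE z in M. h z = k z"
proof -
  define A B where "A = (\<integral>z. h z powr q \<partial>M)" and "B = (\<integral>z. k z powr q \<partial>M)"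
  have AB: "A > 0" "B > 0" unfolding A_def B_def using integral_powr_pos int pos by blast+
  \<comment> \<open>The weight that makes the two terms of the bound have equal integrals.\<close>
  define s where "s = sqrt B / sqrt A"
  have "s > 0" using AB by (simp add: s_def)
  define G where "G = (\<lambda>z. (s * h z powr q + k z powr q / s) / 2)"
  have intG: "integrable M G" unfolding G_def using int by auto
  have "(\<integral>z. G z \<partial>M) = (s * A + B / s) / 2"
    unfolding G_def A_def B_def using int by simp
  also have "\<dots> = sqrt A * sqrt B"
    using AB unfolding s_def by (simp add: field_simps)
  finally have G: "(\<integral>z. G z \<partial>M) = sqrt A * sqrt B" .
  have le: "AE z in M. ((h z + k z) / 2) powr q \<le> G z"
    using pos unfolding G_def
    by eventually_elim (rule midpoint_powr_le(1)[OF _ _ \<open>q < 0\<close> \<open>s > 0\<close>])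
  show intm: "integrable M (\<lambda>z. ((h z + k z) / 2) powr q)"
  proof (rule Bochner_Integration.integrable_bound[OF intG])
    show "AE z in M. norm (((h z + k z) / 2) powr q) \<le> norm (G z)"
      using le by eventually_elim simp
  qed measurable
  assume "(ln (\<integral>z. h z powr q \<partial>M) + ln (\<integral>z. k z powr q \<partial>M)) / 2
    \<le> ln (\<integral>z. ((h z + k z) / 2) powr q \<partial>M)"
  then have "ln (sqrt A * sqrt B) \<le> ln (\<integral>z. ((h z + k z) / 2) powr q \<partial>M)"
    using AB by (simp add: ln_mult ln_sqrt A_def B_def field_simps)
  moreover have "(\<integral>z. ((h z + k z) / 2) powr q \<partial>M) > 0"
  proof (rule integral_powr_pos[OF intm])
    show "AE z in M. (h z + k z) / 2 > 0" using pos by eventually_elim simp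
  qed
  ultimately have "(\<integral>z. G z \<partial>M) \<le> (\<integral>z. ((h z + k z) / 2) powr q \<partial>M)"
    using AB G by simp
  \<comment> \<open>The pointwise bound makes this integrand nonnegative, so an integral that is at
    most zero makes it vanish almost everywhere.\<close>
  then have "(\<integral>z. G z - ((h z + k z) / 2) powr q \<partial>M) \<le> 0"
    using intG intm by simp
  moreover have nonneg: "AE z in M. 0 \<le> G z - ((h z + k z) / 2) powr q"
    using le by eventually_elim simp
  ultimately have "(\<integral>z. G z - ((h z + k z) / 2) powr q \<partial>M) = 0"
    using integral_nonneg_AE[OF nonneg] by linarith
  then have "AE z in M. G z - ((h z + k z) / 2) powr q = 0"
    using integral_nonneg_eq_0_iff_AE[OF _ nonneg] intG intm by simp
  with pos show "AE z in M. h z = k z"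
  proof eventually_elim
    case (elim z)
    then show ?case
      using midpoint_powr_le(2)[of "h z" "k z" q s] \<open>q < 0\<close> \<open>s > 0\<close> by (force simp: G_def)
  qed
qed

section \<open>Measurability, supports and almost sure constancy\<close>

lemma eln_ennreal: "t > 0 \<Longrightarrow> eln (ennreal t) = ereal (ln t)"
  by (simp add: eln_def)

lemma lsc_borel_measurable: "lsc h \<Longrightarrow> h \<in> borel_measurable borel"
  by (auto simp: lsc_def borel_measurable_iff_greater)

text \<open>The set where \<open>u\<close> differs from \<open>a\<close> is open by continuity and
  null by assumption, so it cannot contain a point of the support.\<close>

lemma AE_eq_const_supp:
  fixes u :: "'a :: topological_space \<Rightarrow> real"
  assumes u: "continuous_on UNIV u" and M: "sets M = sets borel"
    and ae: "AE x in M. u x = a" and x: "x \<in> supp M"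
  shows "u x = a"
proof (rule ccontr)
  assume ne: "u x \<noteq> a"
  have op: "open {x. u x \<noteq> a}"
    using u by (intro open_Collect_neq) auto
  then have [measurable]: "{x. u x \<noteq> a} \<in> sets M" using M by simp
  have "space M = UNIV" using sets_eq_imp_space_eq[OF M] by simp
  then have "emeasure M {x. u x \<noteq> a} = 0"
    using ae AE_iff_measurable[of "{x. u x \<noteq> a}" M "\<lambda>x. u x = a"] by simp
  with x ne op show False by (auto simp: supp_def)
qed

text \<open>By Fubini, almost every \<open>x\<close> has \<open>v\<close> almost surely equal to
  \<open>u x\<close>. The constant is \<open>u x0\<close> for one such \<open>x0\<close>, which
  exists because a probability measure is not zero.\<close>

lemma AE_pair_eq_imp_const:
  assumes "prob_space M" "prob_space N"
    and ae: "AE z in M \<Otimes>\<^sub>M N. u (fst z) = v (snd z)"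
  obtains a where "AE x in M. u x = a" "AE y in N. v y = a"
proof -
  interpret M: prob_space M by fact
  interpret N: prob_space N by fact
  interpret pair_sigma_finite M N ..
  have xy: "AE x in M. AE y in N. u x = v y" using AE_pair[OF ae] by simp
  then obtain x0 where y: "AE y in N. u x0 = v y"
    by (metis (mono_tags, lifting) M.AE_False eventually_mono)
  have "AE x in M. u x = u x0"
    using xy
  proof eventually_elim
    case (elim x)
    \<comment> \<open>Two full-measure sets of \<open>y\<close> meet in a full-measure set. The
      resulting equation does not involve \<open>y\<close>, so on a probability space it simply
      holds.\<close>
    with y have "AE y in N. u x = u x0" by eventually_elim simp
    then show ?case by simp
  qed
  moreover have "AE y in N. v y = u x0" using y by eventually_elim simp
  ultimately show thesis using that by blast
qed

section \<open>Finiteness of the dual objective and uniqueness of the sum of the potentials\<close>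

locale dual_problem =
  fixes c :: "'a :: polish_space \<times> 'a \<Rightarrow> real"
    and \<alpha> \<epsilon> :: real and \<mu> \<nu> :: "'a measure"
  assumes compact: "compact (UNIV :: 'a set)"
    and c: "c \<in> D1" and eps: "\<epsilon> > 0" and alpha: "0 < \<alpha>" "\<alpha> < 1"
    and prob: "\<mu> \<in> Prob" "\<nu> \<in> Prob"
begin

abbreviation "P \<equiv> \<mu> \<Otimes>\<^sub>M \<nu>"
abbreviation "q \<equiv> \<alpha> / (\<alpha> - 1)"

lemma q_neg: "q < 0"
  using alpha by (simp add: divide_pos_neg)

lemma sets_mu: "sets \<mu> = sets borel" and sets_nu: "sets \<nu> = sets borel"
  and prob_mu: "prob_space \<mu>" and prob_nu: "prob_space \<nu>"
  using prob by (auto simp: space_prob_algebra)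

text \<open>A Polish space is second countable, so the product of its Borel sigma-algebras is the
  Borel sigma-algebra of the product. Semicontinuity and continuity on pairs thereby give
  measurability for \<open>P\<close>.\<close>

lemma sets_P: "sets P = sets borel"
  using sets_pair_measure_cong[OF sets_mu sets_nu] unfolding borel_prod .

sublocale P: prob_space P
  by (intro prob_space_pair prob_mu prob_nu)

lemma measurable_c: "c \<in> borel_measurable P"
  using c lsc_borel_measurable sets_P by (auto simp: D1_def cong: measurable_cong_sets)

lemma c_nonneg: "c z \<ge> 0"
  using c Metric_space.nonneg[of UNIV "\<lambda>x y. c (x, y)" "fst z" "snd z"] by (simp add: D1_def)

lemma continuous_osum:
  fixes f g :: "'a \<Rightarrow> real"
  assumes "continuous_on UNIV f" "continuous_on UNIV g"
  shows "continuous_on UNIV (f \<oplus>\<^sub>o g)"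
proof -
  have "continuous_on UNIV (\<lambda>z. f (fst z) + g (snd z))"
    by (intro continuous_intros continuous_on_compose2[OF assms(1)]
        continuous_on_compose2[OF assms(2)]) auto
  then show ?thesis by (simp add: osum_def case_prod_unfold)
qed

lemma measurable_osum:
  fixes f g :: "'a \<Rightarrow> real"
  assumes "continuous_on UNIV f" "continuous_on UNIV g"
  shows "f \<oplus>\<^sub>o g \<in> borel_measurable P"
  using borel_measurable_continuous_onI[OF continuous_osum[OF assms]] sets_P
  by (simp cong: measurable_cong_sets)

text \<open>Compactness bounds the continuous sum, and \<open>P\<close> is finite. The linear term
  is thus a genuine integral and additive in the potentials.\<close>

lemma integrable_osum:
  fixes f g :: "'a \<Rightarrow> real"
  assumes "continuous_on UNIV f" "continuous_on UNIV g"
  shows "integrable P (f \<oplus>\<^sub>o g)"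
proof -
  have "compact (UNIV :: ('a \<times> 'a) set)"
    using compact_Times[OF compact compact] by simp
  then have "bounded (range (f \<oplus>\<^sub>o g))"
    using compact_continuous_image[OF continuous_osum[OF assms]] compact_imp_bounded by blast
  then obtain B where "\<And>z. norm ((f \<oplus>\<^sub>o g) z) \<le> B" by (auto simp: bounded_iff)
  then show ?thesis
    using measurable_osum[OF assms] by (intro P.integrable_const_bound[of _ B]) auto
qed

lemma feasibleD:
  assumes "(f, g) \<in> feasible c \<mu> \<nu>"
  shows "continuous_on UNIV f" "continuous_on UNIV g" "AE z in P. c z - (f \<oplus>\<^sub>o g) z > 0"
  using assms by (auto simp: feasible_def)

text \<open>Integrability and positivity keep the argument of \<open>eln\<close> away from infinity
  and zero, so comparisons of objectives become inequalities between reals.\<close>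

lemma objective_eq:
  assumes fg: "(f, g) \<in> feasible c \<mu> \<nu>"
    and int: "integrable P (\<lambda>z. (c z - (f \<oplus>\<^sub>o g) z) powr q)"
  shows "dual_objective \<alpha> \<epsilon> c \<mu> \<nu> (f, g) =
    ereal ((\<integral>z. (f \<oplus>\<^sub>o g) z \<partial>P) - \<epsilon> * ln (\<integral>z. (c z - (f \<oplus>\<^sub>o g) z) powr q \<partial>P)
      + C_alpha_eps \<alpha> \<epsilon>)"
  using P.integral_powr_pos[OF int feasibleD(3)[OF fg]]
  by (simp add: dual_objective_def nn_integral_eq_integral[OF int] eln_ennreal)

lemma optimal_ge:
  assumes "p \<in> optimal_potentials \<alpha> \<epsilon> c \<mu> \<nu>" "p' \<in> feasible c \<mu> \<nu>"
  shows "dual_objective \<alpha> \<epsilon> c \<mu> \<nu> p' \<le> dual_objective \<alpha> \<epsilon> c \<mu> \<nu> p"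
  using assms by (auto simp: optimal_potentials_def dual_value_def intro: SUP_upper)

text \<open>An optimal pair does at least as well as some feasible pair with finite objective,
  whereas an infinite integral would make its objective \<open>-\<infinity>\<close>.\<close>

lemma optimal_integrable:
  assumes opt: "(f, g) \<in> optimal_potentials \<alpha> \<epsilon> c \<mu> \<nu>"
  shows "integrable P (\<lambda>z. (c z - (f \<oplus>\<^sub>o g) z) powr q)"
proof -
  \<comment> \<open>Two potentials equal to -1 add up to -2, strictly below
    \<open>c \<ge> 0\<close>. The base of the power is then at least 2, and since
    \<open>q < 0\<close> the power is at most \<open>2 powr q\<close>.\<close>
  define m where "m = (\<lambda>_ :: 'a. - 1 :: real)"
  have m: "(m \<oplus>\<^sub>o m) z = - 2" for z by (simp add: m_def osum_def case_prod_unfold)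
  have feas: "(m, m) \<in> feasible c \<mu> \<nu>"
    using order.strict_trans2[OF _ c_nonneg, of "- 2"] by (simp add: feasible_def m) (simp add: m_def)
  have int: "integrable P (\<lambda>z. (c z - (m \<oplus>\<^sub>o m) z) powr q)"
    using measurable_c c_nonneg q_neg
    by (intro P.integrable_const_bound[of _ "2 powr q"]) (auto simp: m intro!: powr_mono2')
  have ne: "dual_objective \<alpha> \<epsilon> c \<mu> \<nu> (f, g) \<noteq> - \<infinity>"
    using optimal_ge[OF opt feas] objective_eq[OF feas int] by auto
  have fg: "(f, g) \<in> feasible c \<mu> \<nu>" using opt by (simp add: optimal_potentials_def)
  have "(\<integral>\<^sup>+z. ennreal ((c z - (f \<oplus>\<^sub>o g) z) powr q) \<partial>P) \<noteq> \<infinity>"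
    using ne eps by (auto simp: dual_objective_def eln_def)
  then show ?thesis
    using measurable_c measurable_osum[OF feasibleD(1,2)[OF fg]]
    by (intro integrableI_nonneg) (auto simp: top.not_eq_extremum)
qed

lemma optimal_osum_unique:
  assumes opt: "(f, g) \<in> optimal_potentials \<alpha> \<epsilon> c \<mu> \<nu>"
    and opt': "(f', g') \<in> optimal_potentials \<alpha> \<epsilon> c \<mu> \<nu>"
  shows "AE z in P. (f \<oplus>\<^sub>o g) z = (f' \<oplus>\<^sub>o g') z"
proof -
  have fg: "(f, g) \<in> feasible c \<mu> \<nu>" and fg': "(f', g') \<in> feasible c \<mu> \<nu>"
    using opt opt' by (simp_all add: optimal_potentials_def)
  note C = feasibleD[OF fg] and C' = feasibleD[OF fg']
  define h h' where "h = (\<lambda>z. c z - (f \<oplus>\<^sub>o g) z)" and "h' = (\<lambda>z. c z - (f' \<oplus>\<^sub>o g') z)"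
  have meas: "h \<in> borel_measurable P" "h' \<in> borel_measurable P"
    unfolding h_def h'_def using measurable_c measurable_osum C C' by auto
  have pos: "AE z in P. h z > 0" "AE z in P. h' z > 0"
    using C(3) C'(3) by (simp_all add: h_def h'_def)
  have int: "integrable P (\<lambda>z. h z powr q)" "integrable P (\<lambda>z. h' z powr q)"
    unfolding h_def h'_def using optimal_integrable opt opt' by auto
  define F G where "F = (\<lambda>x. (f x + f' x) / 2)" and "G = (\<lambda>x. (g x + g' x) / 2)"
  have FG: "(F \<oplus>\<^sub>o G) z = ((f \<oplus>\<^sub>o g) z + (f' \<oplus>\<^sub>o g') z) / 2" for z
    by (simp add: F_def G_def osum_def case_prod_unfold field_simps)
  \<comment> \<open>The slack of the averaged pair is the average of the slacks. This gives both its
    feasibility and the integrand of its objective.\<close>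
  have mid: "c z - (F \<oplus>\<^sub>o G) z = (h z + h' z) / 2" for z
    unfolding FG h_def h'_def by (simp add: field_simps)
  have "AE z in P. (F \<oplus>\<^sub>o G) z < c z"
    using pos
  proof eventually_elim
    case (elim z)
    then show ?case using mid[of z] by simp
  qed
  then have feas: "(F, G) \<in> feasible c \<mu> \<nu>"
    using C C' unfolding feasible_def F_def G_def by (auto intro!: continuous_intros)
  note strict = P.ln_integral_powr_strict_midconvex[OF meas pos int q_neg]
  let ?L = "\<lambda>f g. \<integral>z. (f \<oplus>\<^sub>o g) z \<partial>P"
  have "?L F G = (?L f g + ?L f' g') / 2"
    unfolding FG using integrable_osum C C' by simp
  moreover have
    "?L F G - \<epsilon> * ln (\<integral>z. ((h z + h' z) / 2) powr q \<partial>P) \<le> ?L f g - \<epsilon> * ln (\<integral>z. h z powr q \<partial>P)"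
    using optimal_ge[OF opt feas] objective_eq[OF feas] objective_eq[OF fg] int strict(1)
    by (simp add: mid h_def[symmetric] fun_cong[OF h_def, symmetric])
  moreover have
    "?L F G - \<epsilon> * ln (\<integral>z. ((h z + h' z) / 2) powr q \<partial>P) \<le> ?L f' g' - \<epsilon> * ln (\<integral>z. h' z powr q \<partial>P)"
    using optimal_ge[OF opt' feas] objective_eq[OF feas] objective_eq[OF fg'] int strict(1)
    by (simp add: mid fun_cong[OF h'_def, symmetric])
  \<comment> \<open>In the average of the two comparisons the linear terms cancel, because
    \<open>?L F G\<close> is the mean of the other two. What remains is the reversed midpoint
    inequality for \<open>h\<close> and \<open>h'\<close>.\<close>
  ultimately have "\<epsilon> * ((ln (\<integral>z. h z powr q \<partial>P) + ln (\<integral>z. h' z powr q \<partial>P)) / 2)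
      \<le> \<epsilon> * ln (\<integral>z. ((h z + h' z) / 2) powr q \<partial>P)"
    by (simp add: field_simps)
  then have "AE z in P. h z = h' z" using strict(2) eps by simp
  then show ?thesis by (simp add: h_def h'_def)
qed

end

section \<open>Separation of the sum into the two potentials\<close>

theorem proposition2p3:
  fixes c :: "'a :: polish_space \<times> 'a \<Rightarrow> real"
    and \<alpha> \<epsilon> :: real
    and \<mu> \<nu> :: "'a measure"
    and f g f' g' :: "'a \<Rightarrow> real"
  assumes "compact (UNIV :: 'a set)"
    and "c \<in> D1"
    and "\<epsilon> > 0"
    and "\<alpha> \<in> {0<..<1}"
    and "\<mu> \<in> Prob" and "\<nu> \<in> Prob"
    and "(f, g) \<in> optimal_potentials \<alpha> \<epsilon> c \<mu> \<nu>"
    and "(f', g') \<in> optimal_potentials \<alpha> \<epsilon> c \<mu> \<nu>"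
  shows "\<exists>\<gamma> :: real.
    (\<forall>x \<in> supp \<mu>. f x - f' x = \<gamma>) \<and> (\<forall>y \<in> supp \<nu>. g y - g' y = - \<gamma>) \<and>
    (AE x in \<mu>. f x - f' x = \<gamma>) \<and> (AE y in \<nu>. g y - g' y = - \<gamma>)"
proof -
  interpret dual_problem c \<alpha> \<epsilon> \<mu> \<nu>
    using assms by unfold_locales auto
  have fg: "(f, g) \<in> feasible c \<mu> \<nu>" and fg': "(f', g') \<in> feasible c \<mu> \<nu>"
    using assms(7,8) by (simp_all add: optimal_potentials_def)
  note C = feasibleD[OF fg] and C' = feasibleD[OF fg']
  \<comment> \<open>Rearranging the equality of the sums separates the variables: one side depends
    on the first coordinate alone, the other on the second.\<close>
  have "AE z in \<mu> \<Otimes>\<^sub>M \<nu>. f (fst z) - f' (fst z) = g' (snd z) - g (snd z)"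
    using optimal_osum_unique[OF assms(7,8)]
    by eventually_elim (simp add: osum_def case_prod_unfold)
  then obtain \<gamma> where x: "AE x in \<mu>. f x - f' x = \<gamma>" and "AE y in \<nu>. g' y - g y = \<gamma>"
    by (rule AE_pair_eq_imp_const[OF prob_mu prob_nu, where u = "\<lambda>x. f x - f' x"])
  then have y: "AE y in \<nu>. g y - g' y = - \<gamma>" by (auto elim: eventually_mono)
  have "f x - f' x = \<gamma>" if "x \<in> supp \<mu>" for x
    using AE_eq_const_supp[OF _ sets_mu x that] C(1) C'(1) by (simp add: continuous_on_diff)
  moreover have "g y - g' y = - \<gamma>" if "y \<in> supp \<nu>" for y
    using AE_eq_const_supp[OF _ sets_nu y that] C(2) C'(2) by (simp add: continuous_on_diff)
  ultimately show ?thesis using x y by blast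
qed

end
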